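(* Let $k$ be a positive integer and let $T$ be an infinite rooted tree with birth sequence $d_0,d_1,d_2,\dots$, with its root initially on fire. Then $T$ is $k$-containable if and only if there exists some $t\in\mathbb{Z}_{\ge 0}$ such that \[ \prod_{i=0}^t d_i - k\left(1+\sum_{i=1}^t\prod_{j=i}^t d_j\right)\le 0 . \]
   Context: The depth of a vertex in a rooted tree is its distance from the root. A rooted tree has birth sequence $d_0,d_1,d_2,\dots$ if every vertex at depth $i$ has exactly $d_i$ children; the tree being infinite means that all $d_i$ are positive integers. Firefighter process on a graph with vertex set $V$: $F^{(t)}$ is the set of vertices on fire at turn $t$ and $P^{(t)}$ the set of protected vertices at turn $t$. On turn $1$, $F^{(1)}$ is the given initial fire (here the root only) and $P^{(1)}=\varnothing$. On an even turn $2t$, the firefighters choose a subset of $V\setminus F^{(2t-1)}$ to protect; $P^{(2t)}$ is the union of $P^{(2t-1)}$ and this subset, and $F^{(2t)}=F^{(2t-1)}$. On an odd turn $2t+1$ with $t\ge 1$, $F^{(2t+1)}=N[F^{(2t)}]\setminus P^{(2t)}$, where $N[\cdot]$ is the closed neighborhood, and $P^{(2t+1)}=P^{(2t)}$. On turn $t$, a vertex is saved if it is in $P^{(t)}$ or lies in a component of the subgraph induced by $V\setminus P^{(t)}$ that contains no burning vertex. The fire is contained if at some turn all but finitely many vertices are saved. An infinite graph with a given initial fire is $k$-containable if the fire can be contained by protecting at most $k$ vertices on every even turn. *)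

theory Defs
  imports Main
begin

text \<open>
  Graphs are given by a vertex set \<open>V\<close> and a set \<open>E\<close> of two-element subsets of \<open>V\<close>;
  both may be infinite.
\<close>

definition simple_graph :: "'a set \<Rightarrow> 'a set set \<Rightarrow> bool" where
  "simple_graph V E \<longleftrightarrow> (\<forall>e\<in>E. \<exists>u\<in>V. \<exists>v\<in>V. u \<noteq> v \<and> e = {u, v})"

definition walk :: "'a set \<Rightarrow> 'a set set \<Rightarrow> 'a \<Rightarrow> 'a list \<Rightarrow> 'a \<Rightarrow> bool" where
  "walk V E u p v \<longleftrightarrow> p \<noteq> [] \<and> hd p = u \<and> last p = v \<and> set p \<subseteq> V
     \<and> successively (\<lambda>x y. {x, y} \<in> E) p"

definition connected_graph :: "'a set \<Rightarrow> 'a set set \<Rightarrow> bool" where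
  "connected_graph V E \<longleftrightarrow> V \<noteq> {} \<and> (\<forall>u\<in>V. \<forall>v\<in>V. \<exists>p. walk V E u p v)"

text \<open>A cycle is listed without repeating its first vertex at the end.\<close>

definition graph_cycle :: "'a set \<Rightarrow> 'a set set \<Rightarrow> 'a list \<Rightarrow> bool" where
  "graph_cycle V E p \<longleftrightarrow> length p \<ge> 3 \<and> distinct p \<and> walk V E (hd p) p (last p)
     \<and> {last p, hd p} \<in> E"

definition rooted_tree :: "'a set \<Rightarrow> 'a set set \<Rightarrow> 'a \<Rightarrow> bool" where
  "rooted_tree V E r \<longleftrightarrow>
     simple_graph V E \<and> connected_graph V E \<and> (\<nexists>p. graph_cycle V E p) \<and> r \<in> V"

text \<open>A walk listing \<open>n + 1\<close> vertices has length \<open>n\<close>. The value is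
  meaningful only if \<open>u\<close> and \<open>v\<close> are joined by a walk.\<close>

definition graph_dist :: "'a set \<Rightarrow> 'a set set \<Rightarrow> 'a \<Rightarrow> 'a \<Rightarrow> nat" where
  "graph_dist V E u v = (LEAST n. \<exists>p. walk V E u p v \<and> length p = Suc n)"

definition depth :: "'a set \<Rightarrow> 'a set set \<Rightarrow> 'a \<Rightarrow> 'a \<Rightarrow> nat" where
  "depth V E r v = graph_dist V E r v"

definition children :: "'a set \<Rightarrow> 'a set set \<Rightarrow> 'a \<Rightarrow> 'a \<Rightarrow> 'a set" where
  "children V E r v = {w \<in> V. {v, w} \<in> E \<and> depth V E r w = Suc (depth V E r v)}"

definition birth_sequence :: "'a set \<Rightarrow> 'a set set \<Rightarrow> 'a \<Rightarrow> (nat \<Rightarrow> nat) \<Rightarrow> bool" where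
  "birth_sequence V E r d \<longleftrightarrow>
     (\<forall>v\<in>V. finite (children V E r v) \<and> card (children V E r v) = d (depth V E r v))"

definition closed_nbhd :: "'a set \<Rightarrow> 'a set set \<Rightarrow> 'a set \<Rightarrow> 'a set" where
  "closed_nbhd V E S = S \<union> {v \<in> V. \<exists>u\<in>S. {u, v} \<in> E}"

definition induced_edges :: "'a set set \<Rightarrow> 'a set \<Rightarrow> 'a set set" where
  "induced_edges E W = {e \<in> E. e \<subseteq> W}"

definition components_of_graph :: "'a set \<Rightarrow> 'a set set \<Rightarrow> 'a set set" where
  "components_of_graph V E = {{v \<in> V. \<exists>p. walk V E u p v} | u. u \<in> V}"

text \<open>
  \<open>C t\<close> is the set chosen by the firefighters on the even turn \<open>2 * t\<close>, and
  \<open>F n\<close>, \<open>P n\<close> are the burning and protected vertices at turn \<open>n\<close>. Turns start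
  at 1, so \<open>C 0\<close>, \<open>F 0\<close> and \<open>P 0\<close> are unconstrained and play no role.
\<close>

definition firefighter_process ::
  "'a set \<Rightarrow> 'a set set \<Rightarrow> 'a set \<Rightarrow> (nat \<Rightarrow> 'a set) \<Rightarrow> (nat \<Rightarrow> 'a set) \<Rightarrow> (nat \<Rightarrow> 'a set) \<Rightarrow> bool"
where
  "firefighter_process V E F\<^sub>1 C F P \<longleftrightarrow>
     F 1 = F\<^sub>1 \<and> P 1 = {} \<and>
     (\<forall>t\<ge>1.
        C t \<subseteq> V - F (2 * t - 1) \<and>
        P (2 * t) = P (2 * t - 1) \<union> C t \<and>
        F (2 * t) = F (2 * t - 1) \<and>
        F (2 * t + 1) = closed_nbhd V E (F (2 * t)) - P (2 * t) \<and>
        P (2 * t + 1) = P (2 * t))"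

text \<open>Whether a vertex \<open>v\<close> is saved on a turn with burning set \<open>B\<close> and protected set \<open>Q\<close>.\<close>

definition saved :: "'a set \<Rightarrow> 'a set set \<Rightarrow> 'a set \<Rightarrow> 'a set \<Rightarrow> 'a \<Rightarrow> bool" where
  "saved V E B Q v \<longleftrightarrow>
     v \<in> Q \<or> (\<exists>K \<in> components_of_graph (V - Q) (induced_edges E (V - Q)). v \<in> K \<and> K \<inter> B = {})"

definition contained :: "'a set \<Rightarrow> 'a set set \<Rightarrow> (nat \<Rightarrow> 'a set) \<Rightarrow> (nat \<Rightarrow> 'a set) \<Rightarrow> bool" where
  "contained V E F P \<longleftrightarrow> (\<exists>n\<ge>1. finite {v \<in> V. \<not> saved V E (F n) (P n) v})"

definition containable :: "nat \<Rightarrow> 'a set \<Rightarrow> 'a set set \<Rightarrow> 'a set \<Rightarrow> bool" where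
  "containable k V E F\<^sub>1 \<longleftrightarrow>
     (\<exists>C F P. firefighter_process V E F\<^sub>1 C F P \<and> (\<forall>t\<ge>1. finite (C t) \<and> card (C t) \<le> k)
        \<and> contained V E F P)"

lemma depth_least:
  assumes "walk V E r p v" "length p = Suc n"
  shows "depth V E r v \<le> n"
  unfolding depth_def graph_dist_def by (rule Least_le) (use assms in blast)

lemma depth_walk:
  assumes "connected_graph V E" "r \<in> V" "v \<in> V"
  obtains p where "walk V E r p v" "length p = Suc (depth V E r v)"
proof -
  obtain p where p: "walk V E r p v"
    using assms unfolding connected_graph_def by blast
  then have "length p = Suc (length p - 1)" by (auto simp: walk_def)
  then have "\<exists>n p. walk V E r p v \<and> length p = Suc n" using p by blast
  then have "\<exists>p. walk V E r p v \<and> length p = Suc (depth V E r v)"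
    unfolding depth_def graph_dist_def by (rule LeastI_ex)
  then show ?thesis using that by blast
qed

lemma depth_0:
  assumes "connected_graph V E" "r \<in> V" "v \<in> V" "depth V E r v = 0"
  shows "v = r"
  using depth_walk[OF assms(1-3)] assms(4)
  by (metis length_0_conv length_Suc_conv hd_conv_nth last_conv_nth diff_Suc_1 walk_def)

lemma depth_root: "r \<in> V \<Longrightarrow> depth V E r r = 0"
  using depth_least[of V E r "[r]" r 0] by (simp add: walk_def)

lemma ex_parent:
  assumes c: "connected_graph V E" "r \<in> V" and v: "v \<in> V" "depth V E r v = Suc n"
  shows "\<exists>u\<in>V. depth V E r u = n \<and> v \<in> children V E r u"
proof -
  obtain p where p: "walk V E r p v" "length p = Suc (Suc n)"
    using depth_walk[OF c v(1)] v(2) by metis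
  then obtain q where q: "p = q @ [v]" "length q = Suc n"
    by (metis append_butlast_last_id diff_Suc_1 length_butlast walk_def)
  then have q0: "q \<noteq> []" by auto
  define u where "u = last q"
  have wq: "walk V E r q u" and e: "{u, v} \<in> E" and u: "u \<in> V"
    using p(1) q(1) q0 by (auto simp: walk_def u_def successively_append_iff)
  have le: "depth V E r u \<le> n" by (rule depth_least[OF wq q(2)])
  obtain q' where q': "walk V E r q' u" "length q' = Suc (depth V E r u)"
    using depth_walk[OF c u] by blast
  have "walk V E r (q' @ [v]) v"
    using q'(1) e v(1) by (auto simp: walk_def successively_append_iff)
  then have "depth V E r v \<le> Suc (depth V E r u)"
    by (rule depth_least) (simp add: q'(2))
  with le v e u show ?thesis by (auto simp: children_def intro!: bexI[of _ u])
qed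

text \<open>For a tree with a birth sequence, being infinite means that every term is positive.\<close>

lemma infinite_iff_birth_sequence_pos:
  assumes T: "rooted_tree V E r" and b: "birth_sequence V E r d"
  shows "infinite V \<longleftrightarrow> (\<forall>i. d i > 0)"
proof -
  have c: "connected_graph V E" "r \<in> V" using T by (auto simp: rooted_tree_def)
  define L where "L n = {v \<in> V. depth V E r v = n}" for n
  have L0: "L 0 = {r}"
    using depth_0[OF c] depth_root[OF c(2)] c(2) by (auto simp: L_def)
  have LS: "L (Suc n) = (\<Union>u\<in>L n. children V E r u)" for n
    using ex_parent[OF c] by (fastforce simp: L_def children_def)
  have ch: "finite (children V E r u)" "card (children V E r u) = d n" if "u \<in> L n" for u n
    using b that by (auto simp: birth_sequence_def L_def)
  have fin: "finite (L n)" for n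
    by (induction n) (auto simp: L0 LS ch)
  show ?thesis
  proof
    assume inf: "infinite V"
    show "\<forall>i. d i > 0"
    proof (rule ccontr)
      assume "\<not> (\<forall>i. d i > 0)"
      then obtain i where i: "d i = 0" by auto
      have "children V E r u = {}" if "u \<in> L i" for u
        using ch[OF that] i by simp
      then have "L (Suc i) = {}" by (simp add: LS)
      then have emp: "L (Suc i + m) = {}" for m
        by (induction m) (auto simp: LS)
      have "v \<in> (\<Union>n\<le>i. L n)" if v: "v \<in> V" for v
      proof (cases "depth V E r v \<le> i")
        case True
        then show ?thesis using v by (auto simp: L_def)
      next
        case False
        then have "v \<in> L (Suc i + (depth V E r v - Suc i))" using v by (simp add: L_def)
        then show ?thesis using emp by blast
      qed
      then have "V \<subseteq> (\<Union>n\<le>i. L n)" by blast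
      moreover have "finite (\<Union>n\<le>i. L n)" using fin by blast
      ultimately show False using inf finite_subset by blast
    qed
  next
    assume pos: "\<forall>i. d i > 0"
    have "L n \<noteq> {}" for n
    proof (induction n)
      case (Suc n)
      then obtain u where u: "u \<in> L n" by blast
      then have "children V E r u \<noteq> {}" using ch(2)[OF u] pos by (metis card.empty less_irrefl)
      then show ?case using u by (auto simp: LS)
    qed (simp add: L0)
    then have "\<exists>v\<in>V. depth V E r v = n" for n unfolding L_def by blast
    then have "UNIV \<subseteq> depth V E r ` V" by (metis image_eqI subsetI)
    then show "infinite V" by (meson finite_surj infinite_UNIV_nat)
  qed
qed

end

theory Submission
  imports Defs
begin

text \<open>
  The left-hand side of the criterion is governed by a one-term recursion: with
  \<open>A 0 = 1\<close> and \<open>A (Suc j) = d j * A j - k\<close>, the expression for \<open>t\<close> is \<open>A (Suc t)\<close>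
  (\<open>signed_front_Suc_closed_form\<close>). As long as it stays positive, \<open>A j\<close> is the number of
  vertices at depth \<open>j\<close> that catch fire when the firefighters always protect \<open>k\<close> children of
  the vertices burning at the greatest depth.

  If some \<open>A (Suc t)\<close> is at most \<open>0\<close>, this greedy strategy leaves no unprotected child for
  the fire to reach at depth \<open>Suc t\<close> (\<open>greedy_front_le\<close>). The fire then stops while still
  finite, and the vertices that never burnt are all saved (\<open>saved_if_fire_stable\<close>).

  Conversely, no strategy beats the greedy one. The danger is that the firefighters may
  protect vertices far ahead of the fire. Call the vertices at depth \<open>j\<close> that burn on
  turn \<open>2 * j + 1\<close>, the first on which that is possible, the front, and let \<open>X j\<close> count the
  vertices of depth \<open>i \<le> j\<close> that are protected in time, that is by turn \<open>2 * i + 1\<close>. All of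
  these were chosen among the at most \<open>k * j\<close> vertices protected in the first \<open>j\<close> even turns,
  so the balance \<open>X j - k * j\<close> is at most \<open>0\<close>: vertices protected ahead of the fire are
  moves already paid for whose effect is still to come. The sum of the front size and this
  balance is at least \<open>A j\<close>. In the induction the front is multiplied by \<open>d j \<ge> 1\<close> before
  the next blocked vertices are removed, whereas the balance is not, and since the
  balance is nonpositive this only helps the fire (\<open>signed_front_le\<close>). Hence if all \<open>A j\<close>
  are positive, then the front is nonempty at every depth. A vertex that is saved at some
  turn never burns afterwards (\<open>fire_stays_unsaved\<close>), so infinitely many vertices are unsaved
  at every turn.
\<close>

section \<open>The recursion behind the criterion\<close>

text \<open>
  The size of the greedy front as long as the value is positive. It lives in the integers because it is allowed to become
  negative, meaning that the firefighters have protection to spare.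
\<close>

fun signed_front :: "nat \<Rightarrow> (nat \<Rightarrow> nat) \<Rightarrow> nat \<Rightarrow> int" where
  "signed_front k d 0 = 1"
| "signed_front k d (Suc n) = int (d n) * signed_front k d n - int k"

lemma signed_front_Suc_closed_form:
  "signed_front k d (Suc t) =
    (\<Prod>i=0..t. int (d i)) - int k * (1 + (\<Sum>i=1..t. \<Prod>j=i..t. int (d j)))"
proof (induction t)
  case 0
  show ?case by simp
next
  case (Suc t)
  let ?D = "int (d (Suc t))"
  have "(\<Sum>i=1..Suc t. \<Prod>j=i..Suc t. int (d j))
      = (\<Sum>i=1..t. (\<Prod>j=i..t. int (d j)) * ?D) + ?D"
    by simp
  also have "\<dots> = ?D * (1 + (\<Sum>i=1..t. \<Prod>j=i..t. int (d j)))"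
    by (simp add: sum_distrib_left algebra_simps)
  finally show ?case
    unfolding signed_front.simps(2)[of k d "Suc t"] Suc.IH prod.atLeast0_atMost_Suc
    by (simp only:) (simp add: algebra_simps)
qed

section \<open>Rooted trees with a birth sequence\<close>

locale birth_tree =
  fixes V :: "'a set" and E :: "'a set set" and r :: 'a and d :: "nat \<Rightarrow> nat"
  assumes tree: "rooted_tree V E r"
    and birth: "birth_sequence V E r d"
begin

abbreviation dep :: "'a \<Rightarrow> nat" where "dep \<equiv> depth V E r"
abbreviation kids :: "'a \<Rightarrow> 'a set" where "kids \<equiv> children V E r"

definition level :: "nat \<Rightarrow> 'a set" where "level n = {v \<in> V. dep v = n}"
definition offspring :: "'a set \<Rightarrow> 'a set" where "offspring S = (\<Union>u\<in>S. kids u)"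

lemma conn: "connected_graph V E" and root: "r \<in> V"
  using tree by (auto simp: rooted_tree_def)

lemma edge_endpoints:
  assumes "{u, v} \<in> E"
  shows "u \<in> V" "v \<in> V"
proof -
  obtain x y where "x \<in> V" "y \<in> V" "{u, v} = {x, y}"
    using tree assms unfolding rooted_tree_def simple_graph_def by metis
  then show "u \<in> V" "v \<in> V" by (auto simp: doubleton_eq_iff)
qed

lemma level_0: "level 0 = {r}"
  using depth_0[OF conn root] depth_root[OF root] root by (auto simp: level_def)

lemma offspring_level: "S \<subseteq> level n \<Longrightarrow> offspring S \<subseteq> level (Suc n)"
  by (auto simp: offspring_def level_def children_def)

lemma level_Suc: "level (Suc n) = offspring (level n)"
  using ex_parent[OF conn root] by (fastforce simp: level_def offspring_def children_def)

lemma kids_level: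
  assumes "u \<in> level n"
  shows "finite (kids u)" "card (kids u) = d n"
  using birth assms by (auto simp: birth_sequence_def level_def)

lemma finite_level: "finite (level n)"
  by (induction n) (auto simp: level_0 level_Suc offspring_def kids_level)

lemma depth_edge_le:
  assumes "{u, v} \<in> E"
  shows "dep v \<le> Suc (dep u)"
proof -
  have uv: "u \<in> V" "v \<in> V" using edge_endpoints[OF assms] by auto
  obtain p where p: "walk V E r p u" "length p = Suc (dep u)"
    using depth_walk[OF conn root uv(1)] by blast
  then have "walk V E r (p @ [v]) v"
    using assms uv by (auto simp: walk_def successively_append_iff)
  then show ?thesis by (rule depth_least) (simp add: p(2))
qed

text \<open>
  Two vertices of equal depth are joined through their ancestors, climbing from both ends until
  the ancestors coincide. The path contains no vertex deeper than its ends, and at least one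
  further vertex; so one more edge between its ends, or one more vertex below both of them,
  would close a cycle.
\<close>

lemma same_depth_path:
  assumes "u \<in> level n" "v \<in> level n" "u \<noteq> v"
  shows "\<exists>p. walk V E u p v \<and> distinct p \<and> length p \<ge> 3 \<and> (\<forall>x\<in>set p. dep x \<le> n)"
  using assms
proof (induction n arbitrary: u v)
  case 0
  then show ?case by (simp add: level_0)
next
  case (Suc n)
  obtain a where a: "a \<in> level n" "u \<in> kids a" using Suc.prems by (auto simp: level_Suc offspring_def)
  obtain b where b: "b \<in> level n" "v \<in> kids b" using Suc.prems by (auto simp: level_Suc offspring_def)
  have e: "{u, a} \<in> E" "{b, v} \<in> E" and V: "u \<in> V" "v \<in> V" "a \<in> V"
    and dep: "dep u = Suc n" "dep v = Suc n" "dep a = n"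
    using a b Suc.prems by (auto simp: children_def level_def insert_commute)
  show ?case
  proof (cases "a = b")
    case True
    then have "walk V E u [u, a, v] v" using e V by (simp add: walk_def)
    moreover have "distinct [u, a, v]" using dep Suc.prems(3) by auto
    ultimately show ?thesis using dep by (intro exI[of _ "[u, a, v]"]) auto
  next
    case False
    then obtain q where q: "walk V E a q b" "distinct q" "length q \<ge> 3" "\<forall>x\<in>set q. dep x \<le> n"
      using Suc.IH a b by blast
    then have "walk V E u (u # q @ [v]) v"
      using e V by (auto simp: walk_def successively_append_iff successively_Cons)
    moreover have "distinct (u # q @ [v])"
      using q dep Suc.prems(3) by fastforce
    moreover have "\<forall>x\<in>set (u # q @ [v]). dep x \<le> Suc n"
      using q dep by fastforce
    ultimately show ?thesis using q(3) by (intro exI[of _ "u # q @ [v]"]) auto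
  qed
qed

lemma edge_parent_child:
  assumes e: "{u, v} \<in> E"
  shows "v \<in> kids u \<or> u \<in> kids v"
proof -
  have V: "u \<in> V" "v \<in> V" and ne: "u \<noteq> v" and e': "{v, u} \<in> E"
    using edge_endpoints[OF e] tree e
    by (auto simp: rooted_tree_def simple_graph_def insert_commute)
  have "dep u \<noteq> dep v"
  proof
    assume "dep u = dep v"
    then obtain p where "walk V E u p v" "distinct p" "length p \<ge> 3"
      using same_depth_path[of u "dep u" v] V ne by (auto simp: level_def)
    then have "graph_cycle V E p"
      using e' by (auto simp: graph_cycle_def walk_def)
    then show False using tree by (auto simp: rooted_tree_def)
  qed
  then have "dep v = Suc (dep u) \<or> dep u = Suc (dep v)"
    using depth_edge_le[OF e] depth_edge_le[OF e'] by linarith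
  then show ?thesis using V e e' by (auto simp: children_def)
qed

lemma parent_unique:
  assumes "v \<in> kids u" "v \<in> kids w"
  shows "u = w"
proof (rule ccontr)
  assume ne: "u \<noteq> w"
  have e: "{v, u} \<in> E" "{w, v} \<in> E" and dep: "dep v = Suc (dep u)" "dep w = dep u"
    using assms by (auto simp: children_def insert_commute)
  have V: "u \<in> V" "v \<in> V" "w \<in> V" using e edge_endpoints by blast+
  then obtain p where p: "walk V E u p w" "distinct p" "length p \<ge> 3" "\<forall>x\<in>set p. dep x \<le> dep u"
    using same_depth_path[of u "dep u" w] ne dep by (auto simp: level_def)
  then have "graph_cycle V E (v # p)"
    using e V dep by (fastforce simp: graph_cycle_def walk_def successively_Cons)
  then show False using tree by (auto simp: rooted_tree_def)
qed

text \<open>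
  Exact, not just an upper bound, since distinct vertices share no children. The lower bound is
  what keeps the fire alive, the upper bound is what the greedy strategy needs.
\<close>

lemma card_offspring:
  assumes "S \<subseteq> level n"
  shows "card (offspring S) = d n * card S"
proof -
  have "finite S" using assms finite_level finite_subset by blast
  then have "card (offspring S) = (\<Sum>u\<in>S. card (kids u))"
    unfolding offspring_def using assms kids_level parent_unique
    by (intro card_UN_disjoint) blast+
  also have "\<dots> = (\<Sum>u\<in>S. d n)" using assms kids_level by (intro sum.cong) blast+
  finally show ?thesis by simp
qed

end

section \<open>Saved vertices\<close>

lemma saved_edge:
  assumes s: "saved V E B Q v" and e: "{u, v} \<in> E" "u \<in> V" "u \<notin> Q" "v \<notin> Q"
  shows "saved V E B Q u"
proof -
  obtain K where K: "K \<in> components_of_graph (V - Q) (induced_edges E (V - Q))"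
    "v \<in> K" "K \<inter> B = {}"
    using s e by (auto simp: saved_def)
  then obtain w where w: "K = {v \<in> V - Q. \<exists>p. walk (V - Q) (induced_edges E (V - Q)) w p v}"
    by (auto simp: components_of_graph_def)
  then obtain p where p: "walk (V - Q) (induced_edges E (V - Q)) w p v" "v \<in> V"
    using K(2) by blast
  have "{v, u} \<in> induced_edges E (V - Q)"
    using e p(2) by (auto simp: induced_edges_def insert_commute)
  then have "walk (V - Q) (induced_edges E (V - Q)) w (p @ [u]) u"
    using p e by (auto simp: walk_def successively_append_iff)
  then have "u \<in> K" using w e by blast
  then show ?thesis using K by (auto simp: saved_def)
qed

lemma burning_not_saved:
  assumes "v \<in> B" "v \<notin> Q"
  shows "\<not> saved V E B Q v"
  using assms by (auto simp: saved_def)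

text \<open>
  If the fire has no unprotected neighbour outside itself, then no walk avoiding the protected
  vertices can enter it, so no component of the unprotected graph meets both the fire and its
  complement.
\<close>

lemma saved_if_fire_stable:
  assumes stable: "closed_nbhd V E B - Q \<subseteq> B" and v: "v \<in> V" "v \<notin> B"
  shows "saved V E B Q v"
proof (cases "v \<in> Q")
  case True
  then show ?thesis by (simp add: saved_def)
next
  case False
  let ?W = "V - Q" and ?I = "induced_edges E (V - Q)"
  have avoid: "set p \<inter> B = {}"
    if "p \<noteq> []" "hd p \<notin> B" "set p \<subseteq> ?W" "successively (\<lambda>x y. {x, y} \<in> ?I) p" for p
    using that
  proof (induction p)
    case Nil
    then show ?case by simp
  next
    case (Cons x p)
    show ?case
    proof (cases p)
      case Nil
      then show ?thesis using Cons.prems by simp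
    next
      case (Cons y q)
      then have "{y, x} \<in> E" "x \<in> ?W" "x \<notin> B"
        using Cons.prems by (auto simp: induced_edges_def insert_commute)
      then have "y \<notin> B" using stable by (auto simp: closed_nbhd_def)
      then show ?thesis using Cons.IH Cons.prems Cons by simp
    qed
  qed
  define K where "K = {x \<in> ?W. \<exists>p. walk ?W ?I v p x}"
  have "walk ?W ?I v [v] v" using v False by (simp add: walk_def)
  then have "v \<in> K" using v False by (auto simp: K_def)
  moreover have "x \<notin> B" if "x \<in> K" for x
  proof -
    obtain p where p: "p \<noteq> []" "hd p = v" "last p = x" "set p \<subseteq> ?W"
      "successively (\<lambda>x y. {x, y} \<in> ?I) p"
      using \<open>x \<in> K\<close> by (auto simp: K_def walk_def)
    then have "set p \<inter> B = {}" using avoid v(2) by blast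
    then show ?thesis using p last_in_set by blast
  qed
  then have "K \<inter> B = {}" by blast
  moreover have "K \<in> components_of_graph ?W ?I"
    using v False by (auto simp: K_def components_of_graph_def)
  ultimately show ?thesis unfolding saved_def by blast
qed

section \<open>An arbitrary strategy\<close>

locale fire = birth_tree +
  fixes k :: nat and C F P :: "nat \<Rightarrow> 'a set"
  assumes process: "firefighter_process V E {r} C F P"
    and budget: "\<And>t. t \<ge> 1 \<Longrightarrow> finite (C t) \<and> card (C t) \<le> k"
begin

lemma initial: "F (Suc 0) = {r}" "P (Suc 0) = {}"
  using process by (simp_all add: firefighter_process_def)

text \<open>
  The rules of a round, indexed from \<open>0\<close> so that neither subtraction nor a side condition
  occurs: round \<open>n\<close> consists of the turns \<open>2 * n + 2\<close> and \<open>2 * n + 3\<close>.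
\<close>

lemma turn:
  shows "C (Suc n) \<subseteq> V - F (Suc (2 * n))"
    and "P (Suc (Suc (2 * n))) = P (Suc (2 * n)) \<union> C (Suc n)"
    and "F (Suc (Suc (2 * n))) = F (Suc (2 * n))"
    and "F (Suc (Suc (Suc (2 * n)))) = closed_nbhd V E (F (Suc (2 * n))) - P (Suc (Suc (2 * n)))"
    and "P (Suc (Suc (Suc (2 * n)))) = P (Suc (Suc (2 * n)))"
proof -
  have "\<forall>t\<ge>1. C t \<subseteq> V - F (2 * t - 1) \<and> P (2 * t) = P (2 * t - 1) \<union> C t \<and>
      F (2 * t) = F (2 * t - 1) \<and> F (2 * t + 1) = closed_nbhd V E (F (2 * t)) - P (2 * t) \<and>
      P (2 * t + 1) = P (2 * t)"
    using process unfolding firefighter_process_def by blast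
  from this[rule_format, of "Suc n"]
  show "C (Suc n) \<subseteq> V - F (Suc (2 * n))"
    and "P (Suc (Suc (2 * n))) = P (Suc (2 * n)) \<union> C (Suc n)"
    and "F (Suc (Suc (2 * n))) = F (Suc (2 * n))"
    and "F (Suc (Suc (Suc (2 * n)))) = closed_nbhd V E (F (Suc (2 * n))) - P (Suc (Suc (2 * n)))"
    and "P (Suc (Suc (Suc (2 * n)))) = P (Suc (Suc (2 * n)))"
    by auto
qed

lemma burning_unprotected_odd: "F (Suc (2 * n)) \<inter> P (Suc (2 * n)) = {} \<and> F (Suc (2 * n)) \<subseteq> V"
proof (induction n)
  case 0
  then show ?case using initial root by simp
next
  case (Suc n)
  then show ?case using turn[of n] by (auto simp: closed_nbhd_def)
qed

lemma turn_cases: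
  assumes "n \<ge> 1"
  obtains m where "n = Suc (2 * m)" | m where "n = Suc (Suc (2 * m))"
proof (cases "even n")
  case True
  then obtain q where "n = 2 * q" by blast
  then have "n = Suc (Suc (2 * (q - 1)))" using assms by simp
  then show ?thesis using that by blast
next
  case False
  then show ?thesis using that by (auto elim!: oddE)
qed

lemma burning_unprotected:
  assumes "n \<ge> 1"
  shows "F n \<inter> P n = {} \<and> F n \<subseteq> V"
  using assms
proof (cases n rule: turn_cases)
  case (1 m)
  then show ?thesis using burning_unprotected_odd by blast
next
  case (2 m)
  then show ?thesis using burning_unprotected_odd[of m] turn[of m] by auto
qed

lemma turn_mono:
  assumes "n \<ge> 1"
  shows "P n \<subseteq> P (Suc n)" "F (Suc n) \<subseteq> closed_nbhd V E (F n) - P (Suc n)"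
proof -
  have "P n \<subseteq> P (Suc n) \<and> F (Suc n) \<subseteq> closed_nbhd V E (F n) - P (Suc n)"
    using assms
  proof (cases n rule: turn_cases)
    case (1 m)
    then show ?thesis
      using turn[of m] burning_unprotected[of "Suc n"] by (auto simp: closed_nbhd_def)
  next
    case (2 m)
    then show ?thesis using turn[of m] by simp
  qed
  then show "P n \<subseteq> P (Suc n)" "F (Suc n) \<subseteq> closed_nbhd V E (F n) - P (Suc n)"
    by auto
qed

text \<open>
  Later protections only shrink the unprotected graph, so a vertex catching fire after turn \<open>n\<close>
  is joined to a previously burning one by an edge that existed in the unprotected graph of
  turn \<open>n\<close>. Being unsaved at turn \<open>n\<close> spreads along that edge.
\<close>

lemma fire_stays_unsaved:
  assumes n: "n \<ge> 1" and m: "m \<ge> n"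
  shows "F m \<subseteq> {v \<in> V. \<not> saved V E (F n) (P n) v} \<and> P n \<subseteq> P m"
  using m
proof (induction m rule: dec_induct)
  case base
  have "\<not> saved V E (F n) (P n) v \<and> v \<in> V" if "v \<in> F n" for v
    using burning_unprotected[OF n] burning_not_saved that by (metis disjoint_iff subsetD)
  then show ?case by auto
next
  case (step m)
  have m1: "m \<ge> 1" using n step by simp
  have PP: "P n \<subseteq> P (Suc m)" using step.IH turn_mono(1)[OF m1] by blast
  have "\<not> saved V E (F n) (P n) v" if v: "v \<in> F (Suc m)" for v
  proof
    assume s: "saved V E (F n) (P n) v"
    have "v \<in> closed_nbhd V E (F m)" "v \<notin> P n"
      using turn_mono(2)[OF m1] v PP by blast+
    then consider "v \<in> F m" | u where "u \<in> F m" "{u, v} \<in> E"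
      by (auto simp: closed_nbhd_def)
    then show False
    proof cases
      case 1
      then show False using s step.IH by blast
    next
      case 2
      have u: "\<not> saved V E (F n) (P n) u" "u \<in> V" using 2 step.IH by blast+
      then have "u \<notin> P n" by (auto simp: saved_def)
      then show False using saved_edge[OF s 2(2) u(2)] u(1) \<open>v \<notin> P n\<close> by blast
    qed
  qed
  then show ?case using PP burning_unprotected[of "Suc m"] by auto
qed

definition front :: "nat \<Rightarrow> 'a set" where
  "front j = F (Suc (2 * j)) \<inter> level j"

definition blocked :: "nat \<Rightarrow> 'a set" where
  "blocked j = P (Suc (2 * j)) \<inter> level j"

lemma front_Suc: "offspring (front j) \<subseteq> front (Suc j) \<union> blocked (Suc j)"
proof -
  have "offspring (front j) \<subseteq> closed_nbhd V E (F (Suc (2 * j)))"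
    by (auto simp: offspring_def front_def closed_nbhd_def children_def)
  moreover have "offspring (front j) \<subseteq> level (Suc j)"
    by (rule offspring_level) (simp add: front_def)
  ultimately show ?thesis using turn[of j] by (auto simp: front_def blocked_def)
qed

lemma finite_front: "finite (front j)" and finite_blocked: "finite (blocked j)"
  using finite_level by (auto simp: front_def blocked_def)

lemma protected_card: "finite (P (Suc (2 * j))) \<and> card (P (Suc (2 * j))) \<le> k * j"
proof (induction j)
  case 0
  then show ?case using initial by simp
next
  case (Suc j)
  have "card (P (Suc (2 * j)) \<union> C (Suc j)) \<le> card (P (Suc (2 * j))) + card (C (Suc j))"
    by (rule card_Un_le)
  then show ?case using Suc turn[of j] budget[of "Suc j"] by simp
qed

lemma protected_mono: "i \<le> j \<Longrightarrow> P (Suc (2 * i)) \<subseteq> P (Suc (2 * j))"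
  by (induction j rule: dec_induct) (use turn in auto)

text \<open>
  The blocked vertices of different depths are distinct, and all of them are protected by
  turn \<open>2 * j + 1\<close>, whichever even turn they were chosen on.
\<close>

lemma sum_blocked: "(\<Sum>i\<le>j. card (blocked i)) \<le> k * j"
proof -
  have "(\<Sum>i\<le>j. card (blocked i)) = card (\<Union>i\<le>j. blocked i)"
    by (rule card_UN_disjoint[symmetric]) (use finite_blocked in \<open>auto simp: blocked_def level_def\<close>)
  also have "\<dots> \<le> card (P (Suc (2 * j)))"
    by (intro card_mono) (use protected_card protected_mono in \<open>auto simp: blocked_def\<close>)
  also have "\<dots> \<le> k * j" using protected_card by blast
  finally show ?thesis .
qed

text \<open>
  Subtracting \<open>k * j\<close> and crediting the vertices blocked so far is what makes the induction work
  against protection placed far ahead of the fire: the front alone may exceed the bound for a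
  long time and then shrink by more than \<open>k\<close> in one step.
\<close>

lemma signed_front_le:
  assumes pos: "\<And>i. d i > 0"
  shows "signed_front k d j \<le> int (card (front j)) + int (\<Sum>i\<le>j. card (blocked i)) - int (k * j)"
proof (induction j)
  case 0
  have "front 0 = {r}" "blocked 0 = {}" using initial by (auto simp: front_def blocked_def level_0)
  then show ?case by simp
next
  case (Suc j)
  let ?f = "\<lambda>j. int (card (front j))" and ?X = "\<lambda>j. int (\<Sum>i\<le>j. card (blocked i))"
  let ?balance = "?X j - int (k * j)"
  have "d j * card (front j) = card (offspring (front j))"
    by (rule card_offspring[symmetric]) (simp add: front_def)
  also have "\<dots> \<le> card (front (Suc j) \<union> blocked (Suc j))"
    by (intro card_mono front_Suc) (simp add: finite_front finite_blocked)
  also have "\<dots> \<le> card (front (Suc j)) + card (blocked (Suc j))" by (rule card_Un_le)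
  finally have grow: "int (d j) * ?f j \<le> ?f (Suc j) + int (card (blocked (Suc j)))"
    by (metis of_nat_add of_nat_le_iff of_nat_mult)
  \<comment> \<open>Protection spent ahead of the fire does not multiply with the fire.\<close>
  have "?balance \<le> 0" using sum_blocked[of j] by linarith
  then have "int (d j) * ?balance \<le> ?balance"
    using pos[of j] mult_right_mono_neg[of 1 "int (d j)" ?balance] by simp
  moreover have "int (d j) * signed_front k d j \<le> int (d j) * (?f j + ?balance)"
    using Suc.IH by (intro mult_left_mono) auto
  ultimately have "signed_front k d (Suc j) \<le> int (d j) * ?f j + ?balance - int k"
    by (simp add: distrib_left)
  also have "\<dots> \<le> ?f (Suc j) + ?X (Suc j) - int (k * Suc j)"
    using grow by (simp add: algebra_simps)
  finally show ?case .
qed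

lemma contained_imp_signed_front_nonpos:
  assumes pos: "\<And>i. d i > 0" and "contained V E F P"
  shows "\<exists>j. signed_front k d j \<le> 0"
proof (rule ccontr)
  assume "\<not> (\<exists>j. signed_front k d j \<le> 0)"
  then have "signed_front k d j > 0" for j by (simp add: not_le)
  then have "int (card (front j)) > 0" for j
    using signed_front_le[OF pos, of j] sum_blocked[of j] by (smt (verit) of_nat_mono)
  then have ne: "front j \<noteq> {}" for j by (metis card.empty of_nat_0 less_irrefl)
  obtain n where n: "n \<ge> 1" "finite {v \<in> V. \<not> saved V E (F n) (P n) v}" (is "finite ?U")
    using assms by (auto simp: contained_def)
  have "j \<in> dep ` ?U" if j: "j \<ge> n" for j
  proof -
    obtain v where v: "v \<in> F (Suc (2 * j))" "dep v = j"
      using ne[of j] by (auto simp: front_def level_def)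
    moreover have "F (Suc (2 * j)) \<subseteq> ?U" using fire_stays_unsaved[OF n(1), of "Suc (2 * j)"] j by simp
    ultimately show ?thesis by blast
  qed
  then have "{n..} \<subseteq> dep ` ?U" by auto
  then show False using n(2) infinite_Ici finite_surj by blast
qed

end

section \<open>The greedy strategy\<close>

definition choose_upto :: "nat \<Rightarrow> 'a set \<Rightarrow> 'a set" where
  "choose_upto k X = (SOME S. S \<subseteq> X \<and> card S = min k (card X))"

lemma choose_upto: "choose_upto k X \<subseteq> X" "card (choose_upto k X) = min k (card X)"
proof -
  have "\<exists>S. S \<subseteq> X \<and> card S = min k (card X)"
    by (metis min.cobounded2 obtain_subset_with_card_n)
  from someI_ex[OF this]
  show "choose_upto k X \<subseteq> X" "card (choose_upto k X) = min k (card X)"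
    by (simp_all add: choose_upto_def)
qed

context birth_tree
begin

primrec greedy_front :: "nat \<Rightarrow> nat \<Rightarrow> 'a set" where
  "greedy_front k 0 = {r}"
| "greedy_front k (Suc j) =
     offspring (greedy_front k j) - choose_upto k (offspring (greedy_front k j))"

primrec greedy_guard :: "nat \<Rightarrow> nat \<Rightarrow> 'a set" where
  "greedy_guard k 0 = {}"
| "greedy_guard k (Suc j) = choose_upto k (offspring (greedy_front k j))"

declare greedy_front.simps(2) [simp del] greedy_guard.simps(2) [simp del]

lemma greedy_split:
  "offspring (greedy_front k j) = greedy_front k (Suc j) \<union> greedy_guard k (Suc j)"
  using choose_upto(1)[of k "offspring (greedy_front k j)"]
  by (auto simp: greedy_front.simps(2) greedy_guard.simps(2))

lemma greedy_front_level: "greedy_front k j \<subseteq> level j"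
proof (induction j)
  case (Suc j)
  then show ?case using offspring_level greedy_split by blast
qed (simp add: level_0)

lemma greedy_guard_level: "greedy_guard k j \<subseteq> level j"
proof (cases j)
  case (Suc i)
  then show ?thesis
    using offspring_level[OF greedy_front_level] greedy_split by blast
qed simp

lemma greedy_guard_card: "finite (greedy_guard k j) \<and> card (greedy_guard k j) \<le> k"
  using finite_subset[OF greedy_guard_level[of k j] finite_level]
  by (cases j) (simp_all add: greedy_guard.simps(2) choose_upto(2))

lemma greedy_front_guard_disjoint: "greedy_front k i \<inter> greedy_guard k j = {}"
proof (cases "i = j")
  case True
  then show ?thesis by (cases j) (auto simp: greedy_front.simps(2) greedy_guard.simps(2))
next
  case False
  then show ?thesis using greedy_front_level[of k i] greedy_guard_level[of k j]
    by (auto simp: level_def)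
qed

text \<open>
  The fire spreads only downwards: the parent of a vertex of a front lies in the previous front,
  and every child of a front vertex belongs to the next front or the next guard.
\<close>

lemma greedy_nbhd:
  "closed_nbhd V E (\<Union>i\<le>j. greedy_front k i)
    = (\<Union>i\<le>Suc j. greedy_front k i) \<union> (\<Union>i\<le>Suc j. greedy_guard k i)"  (is "?N = ?R")
proof
  show "?N \<subseteq> ?R"
  proof
    fix v assume "v \<in> ?N"
    then consider "v \<in> (\<Union>i\<le>j. greedy_front k i)"
      | i u where "i \<le> j" "u \<in> greedy_front k i" "{u, v} \<in> E"
      by (auto simp: closed_nbhd_def)
    then show "v \<in> ?R"
    proof cases
      case 1
      then show ?thesis by (auto intro: le_SucI)
    next
      case 2
      from edge_parent_child[OF 2(3)] show ?thesis
      proof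
        assume "v \<in> kids u"
        then have "v \<in> greedy_front k (Suc i) \<union> greedy_guard k (Suc i)"
          using 2(2) unfolding greedy_split[symmetric] by (auto simp: offspring_def)
        then show ?thesis using 2(1) by auto
      next
        assume u: "u \<in> kids v"
        then obtain l where l: "i = Suc l"
          using 2(2) greedy_front_level[of k i] by (cases i) (auto simp: level_def children_def)
        then obtain w where "w \<in> greedy_front k l" "u \<in> kids w"
          using 2(2) greedy_split[of k l] by (auto simp: offspring_def)
        then have "v \<in> greedy_front k l" using parent_unique[OF u] by blast
        then show ?thesis using 2(1) l by auto
      qed
    qed
  qed
  have "greedy_front k i \<union> greedy_guard k i \<subseteq> ?N" if i: "i \<le> Suc j" for i
  proof (cases i)
    case 0
    have "greedy_front k 0 \<subseteq> (\<Union>i\<le>j. greedy_front k i)" by blast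
    then show ?thesis using 0 by (simp add: closed_nbhd_def)
  next
    case (Suc l)
    have "offspring (greedy_front k l) \<subseteq> ?N"
      using i Suc by (auto simp: offspring_def closed_nbhd_def children_def)
    then show ?thesis unfolding greedy_split Suc .
  qed
  then show "?R \<subseteq> ?N" by (meson Un_least UN_least Un_subset_iff atMost_iff)
qed

text \<open>
  The fire gains a front on every odd turn, the protected set a guard on every even turn,
  which explains the two halves: front \<open>i\<close> appears on turn \<open>2 * i + 1\<close> and guard \<open>i\<close> on turn
  \<open>2 * i\<close>.
\<close>

lemma greedy_process:
  "firefighter_process V E {r} (greedy_guard k)
     (\<lambda>n. \<Union>i\<le>(n - 1) div 2. greedy_front k i) (\<lambda>n. \<Union>i\<le>n div 2. greedy_guard k i)"
  unfolding firefighter_process_def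
proof (intro conjI allI impI)
  fix t :: nat assume "t \<ge> 1"
  then obtain j where t: "t = Suc j" by (cases t) auto
  have disj: "(\<Union>i\<le>m. greedy_front k i) \<inter> (\<Union>i\<le>n. greedy_guard k i) = {}" for m n
    using greedy_front_guard_disjoint by blast
  show "greedy_guard k t \<subseteq> V - (\<Union>i\<le>(2 * t - 1 - 1) div 2. greedy_front k i)"
    using greedy_guard_level[of k t] greedy_front_guard_disjoint by (fastforce simp: level_def)
  show "(\<Union>i\<le>2 * t div 2. greedy_guard k i)
      = (\<Union>i\<le>(2 * t - 1) div 2. greedy_guard k i) \<union> greedy_guard k t"
    using t by (auto simp: atMost_Suc)
  show "(\<Union>i\<le>(2 * t - 1) div 2. greedy_front k i) = (\<Union>i\<le>(2 * t - 1 - 1) div 2. greedy_front k i)"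
    using t by simp
  show "(\<Union>i\<le>(2 * t + 1 - 1) div 2. greedy_front k i)
      = closed_nbhd V E (\<Union>i\<le>(2 * t - 1) div 2. greedy_front k i) - (\<Union>i\<le>2 * t div 2. greedy_guard k i)"
    using greedy_nbhd[of k j] disj[of "Suc j" "Suc j"] t by auto
  show "(\<Union>i\<le>(2 * t + 1) div 2. greedy_guard k i) = (\<Union>i\<le>2 * t div 2. greedy_guard k i)"
    by simp
qed auto

text \<open>
  An empty front stays empty, whereas \<open>signed_front\<close> may drop below \<open>0\<close>; hence the first
  alternative.
\<close>

lemma greedy_front_le:
  "greedy_front k j = {} \<or> int (card (greedy_front k j)) \<le> signed_front k d j"
proof (induction j)
  case (Suc j)
  show ?case
  proof (cases "greedy_front k j = {}")
    case True
    then show ?thesis by (simp add: offspring_def greedy_front.simps(2))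
  next
    case False
    let ?X = "offspring (greedy_front k j)"
    have X: "card ?X = d j * card (greedy_front k j)"
      by (rule card_offspring[OF greedy_front_level])
    have fin: "finite ?X"
      using offspring_level[OF greedy_front_level] finite_level finite_subset by blast
    have "card (greedy_front k (Suc j)) = card ?X - card (choose_upto k ?X)"
      using fin choose_upto(1)[of k ?X] by (simp add: greedy_front.simps(2) card_Diff_subset finite_subset)
    then have c: "card (greedy_front k (Suc j)) = card ?X - k"
      by (simp add: choose_upto(2))
    have "int (card ?X) \<le> int (d j) * signed_front k d j"
      using Suc False X by (auto intro: mult_left_mono)
    moreover have "finite (greedy_front k (Suc j))" using fin by (simp add: greedy_front.simps(2))
    ultimately show ?thesis using c by (cases "card ?X \<le> k") auto
  qed
qed simp

lemma containable_if_signed_front_nonpos: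
  assumes "signed_front k d (Suc j) \<le> 0"
  shows "containable k V E {r}"
proof -
  let ?F = "\<lambda>n. \<Union>i\<le>(n - 1) div 2. greedy_front k i"
  let ?P = "\<lambda>n. \<Union>i\<le>n div 2. greedy_guard k i"
  let ?n = "2 * Suc j"
  have fin: "finite (greedy_front k i)" for i
    by (rule finite_subset[OF greedy_front_level finite_level])
  have "greedy_front k (Suc j) = {} \<or> card (greedy_front k (Suc j)) = 0"
    using greedy_front_le[of k "Suc j"] assms by linarith
  then have "greedy_front k (Suc j) = {}" using fin by auto
  then have "closed_nbhd V E (?F ?n) - ?P ?n \<subseteq> ?F ?n"
    using greedy_nbhd[of k j] by (auto simp: atMost_Suc)
  then have "saved V E (?F ?n) (?P ?n) v" if "v \<in> V" "v \<notin> ?F ?n" for v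
    by (rule saved_if_fire_stable[OF _ that])
  then have "{v \<in> V. \<not> saved V E (?F ?n) (?P ?n) v} \<subseteq> ?F ?n" by blast
  moreover have "finite (?F ?n)" using fin by blast
  ultimately have "finite {v \<in> V. \<not> saved V E (?F ?n) (?P ?n) v}" by (rule finite_subset)
  then have "contained V E ?F ?P"
    unfolding contained_def by (intro exI[of _ ?n]) auto
  then show ?thesis
    unfolding containable_def using greedy_process greedy_guard_card by blast
qed

end

theorem theorem1p3:
  fixes V :: "'a set" and E :: "'a set set" and r :: 'a and d :: "nat \<Rightarrow> nat" and k :: nat
  assumes "k > 0"
    and "rooted_tree V E r"
    and "infinite V"
    and "birth_sequence V E r d"
  shows "containable k V E {r} \<longleftrightarrow>
    (\<exists>t::nat. (\<Prod>i=0..t. int (d i)) - int k * (1 + (\<Sum>i=1..t. \<Prod>j=i..t. int (d j))) \<le> 0)"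
proof -
  interpret birth_tree V E r d using assms by unfold_locales
  have pos: "d i > 0" for i
    using infinite_iff_birth_sequence_pos[OF assms(2,4)] assms(3) by simp
  have "containable k V E {r} \<longleftrightarrow> (\<exists>t. signed_front k d (Suc t) \<le> 0)"
  proof
    assume "containable k V E {r}"
    then obtain C F P where "firefighter_process V E {r} C F P"
      "\<forall>t\<ge>1. finite (C t) \<and> card (C t) \<le> k" and c: "contained V E F P"
      by (auto simp: containable_def)
    then interpret fire V E r d k C F P by unfold_locales auto
    obtain j where j: "signed_front k d j \<le> 0"
      using contained_imp_signed_front_nonpos[OF pos c] by blast
    then have "j \<noteq> 0" by (metis signed_front.simps(1) not_one_le_zero)
    then show "\<exists>t. signed_front k d (Suc t) \<le> 0" using j not0_implies_Suc by blast
  next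
    assume "\<exists>t. signed_front k d (Suc t) \<le> 0"
    then show "containable k V E {r}" using containable_if_signed_front_nonpos by blast
  qed
  then show ?thesis by (simp only: signed_front_Suc_closed_form)
qed

end
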